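(* Let $\alpha,\theta>0$ and let $\{N(t),\,t\ge 0\}$ be a Bell-Touchard process with parameters $(\alpha,\theta)$. Put $c_n=\alpha\theta^n/n!$ for $n\ge1$. Then for all $t>0$ and $k\in\mathbb{N}$, $$\Pr[N(t)=k]=\exp\Big\{-\sum_{n=1}^{\infty}t c_n\Big\}\sum_{r_1+2r_2+\dots+kr_k=k}\frac{(tc_1)^{r_1}(tc_2)^{r_2}\cdots(tc_k)^{r_k}}{r_1!\,r_2!\cdots r_k!},$$ where the sum is over all $(r_1,\dots,r_k)\in\mathbb{N}_0^k$ with $r_1+2r_2+\dots+kr_k=k$.
   Context: $\mathbb{N}=\{1,2,\dots\}$, $\mathbb{N}_0=\mathbb{N}\cup\{0\}$. A counting process $\{N(t),t\ge0\}$ is an $\mathbb{N}_0$-valued stochastic process where $N(t)$ is the number of events that have occurred up to time $t$ (so it is nondecreasing in $t$). A function $f:\mathbb{R}\to\mathbb{R}$ is $o(s)$ if $\lim_{s\to0}f(s)/s=0$. A counting process is a Bell-Touchard process with parameters $(\alpha,\theta)$, $\alpha,\theta>0$, if (1) $N(0)=0$; (2) it has stationary and independent increments; (3) $\Pr[N(t+s)-N(t)=k]=\alpha s\,\theta^k/k!+o(s)$ for every $k\in\mathbb{N}$ and $s,t>0$. (The displayed formula is the marginal law of the multiple Poisson process depending on a nonnegative summable sequence $\{c_n\}_{n\ge1}$.) *)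

theory Defs
  imports "HOL-Probability.Probability"
begin

(* Time is the half-line {0..}; the values N t for t < 0 are irrelevant throughout. *)
locale counting_process = prob_space M
  for M :: "'a measure" +
  fixes N :: "real \<Rightarrow> 'a \<Rightarrow> nat"
  assumes rv: "\<And>t. 0 \<le> t \<Longrightarrow> random_variable (count_space UNIV) (N t)"
    and nondecreasing: "\<And>s t \<omega>. 0 \<le> s \<Longrightarrow> s \<le> t \<Longrightarrow> \<omega> \<in> space M \<Longrightarrow> N s \<omega> \<le> N t \<omega>"

(* Number of events in (s, t].  For a counting process and 0 \<le> s \<le> t the truncated
   subtraction on nat is the ordinary difference on space M. *)
definition increment :: "(real \<Rightarrow> 'a \<Rightarrow> nat) \<Rightarrow> real \<Rightarrow> real \<Rightarrow> 'a \<Rightarrow> nat" where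
  "increment N s t = (\<lambda>\<omega>. N t \<omega> - N s \<omega>)"

definition stationary_increments :: "'a measure \<Rightarrow> (real \<Rightarrow> 'a \<Rightarrow> nat) \<Rightarrow> bool" where
  "stationary_increments M N \<longleftrightarrow>
     (\<forall>t\<ge>0. \<forall>u\<ge>0. \<forall>s>0.
        distr M (count_space UNIV) (increment N t (t + s)) =
        distr M (count_space UNIV) (increment N u (u + s)))"

definition independent_increments :: "'a measure \<Rightarrow> (real \<Rightarrow> 'a \<Rightarrow> nat) \<Rightarrow> bool" where
  "independent_increments M N \<longleftrightarrow>
     (\<forall>(n::nat) (\<tau> :: nat \<Rightarrow> real).
        0 \<le> \<tau> 0 \<longrightarrow> (\<forall>i<n. \<tau> i < \<tau> (Suc i)) \<longrightarrow>
        prob_space.indep_vars M (\<lambda>_. count_space UNIV)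
          (\<lambda>i. increment N (\<tau> i) (\<tau> (Suc i))) {..<n})"

definition is_little_o :: "(real \<Rightarrow> real) \<Rightarrow> bool" where
  "is_little_o f \<longleftrightarrow> ((\<lambda>s. f s / s) \<longlongrightarrow> 0) (at 0)"

(* The remainder f may depend on k and t.  As the expansion constrains f only at s > 0,
   the two-sided limit in is_little_o amounts to a limit as s tends to 0 from the right. *)
locale bell_touchard_process = counting_process M N
  for M :: "'a measure" and N :: "real \<Rightarrow> 'a \<Rightarrow> nat" +
  fixes \<alpha> \<theta> :: real
  assumes alpha_pos: "\<alpha> > 0"
    and theta_pos: "\<theta> > 0"
    and start_0: "\<And>\<omega>. \<omega> \<in> space M \<Longrightarrow> N 0 \<omega> = 0"
    and stationary: "stationary_increments M N"
    and independent: "independent_increments M N"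
    and small_increments: "\<And>(k::nat) t. 1 \<le> k \<Longrightarrow> 0 < t \<Longrightarrow>
          \<exists>f. is_little_o f \<and>
            (\<forall>s>0. measure M {\<omega> \<in> space M. increment N t (t + s) \<omega> = k}
                     = \<alpha> * s * \<theta> ^ k / fact k + f s)"

(* Tuples (r 1, ..., r k) of naturals with r 1 + 2 * r 2 + ... + k * r k = k, as functions
   that are undefined outside {1..k}, so that each tuple is counted exactly once. *)
definition weighted_tuples :: "nat \<Rightarrow> (nat \<Rightarrow> nat) set" where
  "weighted_tuples k = {r \<in> {1..k} \<rightarrow>\<^sub>E UNIV. (\<Sum>i=1..k. i * r i) = k}"

lemma finite_weighted_tuples: "finite (weighted_tuples k)"
proof (rule finite_subset)
  show "weighted_tuples k \<subseteq> {1..k} \<rightarrow>\<^sub>E {0..k}"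
  proof
    fix r assume r: "r \<in> weighted_tuples k"
    have "r i \<le> k" if i: "i \<in> {1..k}" for i
    proof -
      have "r i \<le> i * r i" using i by simp
      also have "\<dots> \<le> (\<Sum>i=1..k. i * r i)" using i by (intro member_le_sum) auto
      finally show ?thesis using r by (simp add: weighted_tuples_def)
    qed
    with r show "r \<in> {1..k} \<rightarrow>\<^sub>E {0..k}"
      by (auto simp: weighted_tuples_def PiE_iff)
  qed
qed (auto intro: finite_PiE)

end

theory Submission
  imports Defs "HOL-Real_Asymp.Real_Asymp" "HOL-Computational_Algebra.Formal_Power_Series"
begin

text \<open>
  Write $p_s(k)$ for the probability of $k$ events up to time $s > 0$. Stationary independent
  increments say that $(p_s)$ is a convolution semigroup of probability distributions on the
  naturals, and the small-time expansion gives $p_s(k)/s \to c_k$ for each $k \ge 1$. The expansion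
  is not assumed to be uniform in $k$, so it does not by itself say how fast $1 - p_s(0)$ tends to
  $0$; in particular the total rate of jumps has to be identified with $\sum_n c_n$ by another
  argument.

  Everything follows from the recurrence
  \[ k\,p_t(k) = t \sum_{j=1}^{k} j\,c_j\,p_t(k-j). \]
  It is a count of events by pieces: cut $(0,t]$ into $n$ equal pieces of length $h = t/n$. On the
  event of $k$ points in all, $k$ is the sum of the contents of the pieces; by exchangeability each
  piece contributes the same expectation, so
  $k\,p_t(k) = n \sum_{j=1}^{k} j\,p_h(j)\,p_{t-h}(k-j)$. In terms of the generating
  function $P_t = P_h^n$ this is the coefficient form of $P_t' = n P_h' P_h^{n-1}$
  (lemma \<open>discrete_recurrence\<close>). As $n \to \infty$, $n\,p_h(j) \to t c_j$ and
  $p_{t-h} \to p_t$ (lemma \<open>recurrence\<close>). The sum over weighted tuples solves the same recurrence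
  with value $1$ at $0$ (lemma \<open>sum_tuple_weight_recurrence\<close>), so $p_t(k)$ is $p_t(0)$ times
  that sum.

  It remains to find $p_t(0)$. Since $p_{t/n}(0)^n = p_t(0)$, the quantity $n(1 - p_{t/n}(0))$ tends
  to $-\ln p_t(0)$. Keeping only finitely many values of the increment bounds this limit below by
  $t \sum_{j \le K} c_j$ for every $K$. For the upper bound, the recurrence at time $h$ and
  $j \le k$ give $p_h(k) \le h \sum_{j \le k} c_j\,p_h(k-j)$; summing over $k \ge 1$ turns the right
  side into a Cauchy product and yields $1 - p_h(0) \le h \sum_n c_n$. Hence
  $p_t(0) = \exp(-t \sum_n c_n)$ (lemma \<open>zero_eq_exp\<close>).
\<close>

section \<open>The recurrence for sums over weighted tuples\<close>

definition tuple_weight :: "nat set \<Rightarrow> (nat \<Rightarrow> real) \<Rightarrow> (nat \<Rightarrow> nat) \<Rightarrow> real" where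
  "tuple_weight I x r = (\<Prod>i\<in>I. x i ^ r i / fact (r i))"

text \<open>
  The indices range over a set \<open>I\<close> that is independent of the weight \<open>k\<close>: the recurrence below lowers
  the weight and must leave the index set alone.
\<close>

definition tuples_of_weight :: "nat set \<Rightarrow> nat \<Rightarrow> (nat \<Rightarrow> nat) set" where
  "tuples_of_weight I k = {r \<in> I \<rightarrow>\<^sub>E UNIV. (\<Sum>i\<in>I. i * r i) = k}"

lemma finite_tuples_of_weight:
  assumes "finite I" "0 \<notin> I"
  shows "finite (tuples_of_weight I k)"
proof (rule finite_subset)
  show "tuples_of_weight I k \<subseteq> I \<rightarrow>\<^sub>E {0..k}"
  proof
    fix r assume r: "r \<in> tuples_of_weight I k"
    have "r i \<le> k" if i: "i \<in> I" for i
    proof -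
      have "i \<noteq> 0" using i assms by metis
      then have "r i \<le> i * r i" by simp
      also have "\<dots> \<le> (\<Sum>i\<in>I. i * r i)" using i assms by (intro member_le_sum) auto
      finally show ?thesis using r by (simp add: tuples_of_weight_def)
    qed
    with r show "r \<in> I \<rightarrow>\<^sub>E {0..k}"
      by (auto simp: tuples_of_weight_def PiE_iff)
  qed
qed (use assms in \<open>auto intro: finite_PiE\<close>)

text \<open>
  The factor \<open>r j\<close> discards the tuples with \<open>r j = 0\<close>. On the others, lowering entry \<open>j\<close> by one is a
  bijection onto the tuples of weight \<open>k - j\<close>, and \<open>r j / fact (r j) = 1 / fact (r j - 1)\<close>
  absorbs the factor, leaving one power of \<open>x j\<close> over.
\<close>

lemma sum_marked_tuple_weight:
  assumes I: "finite I" "0 \<notin> I" and j: "j \<in> I"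
  shows "(\<Sum>r\<in>tuples_of_weight I k. real (r j) * tuple_weight I x r) =
         (if j \<le> k then x j * (\<Sum>r\<in>tuples_of_weight I (k - j). tuple_weight I x r) else 0)"
proof -
  let ?inc = "\<lambda>r::nat \<Rightarrow> nat. r(j := Suc (r j))"
  let ?dec = "\<lambda>r::nat \<Rightarrow> nat. r(j := r j - 1)"
  have total: "(\<Sum>i\<in>I. i * r i) = j * r j + (\<Sum>i\<in>I - {j}. i * r i)" for r
    using I j by (simp add: sum.remove)
  have others: "(\<Sum>i\<in>I - {j}. i * (r(j := m)) i) = (\<Sum>i\<in>I - {j}. i * r i)" for r and m :: nat
    by (intro sum.cong) auto
  have weight: "real (Suc (r j)) * tuple_weight I x (?inc r) = x j * tuple_weight I x r" for r
  proof -
    have "(\<Prod>i\<in>I - {j}. x i ^ ?inc r i / fact (?inc r i)) =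
          (\<Prod>i\<in>I - {j}. x i ^ r i / fact (r i))"
      by (intro prod.cong) auto
    then show ?thesis
      using I j by (simp add: tuple_weight_def prod.remove[of I j] field_simps del: of_nat_Suc)
  qed
  show ?thesis
  proof (cases "j \<le> k")
    case True
    have "(\<Sum>r\<in>tuples_of_weight I k. real (r j) * tuple_weight I x r) =
          (\<Sum>r\<in>{r\<in>tuples_of_weight I k. r j \<noteq> 0}. real (r j) * tuple_weight I x r)"
      by (intro sum.mono_neutral_right finite_tuples_of_weight I) auto
    also have "\<dots> = (\<Sum>r\<in>tuples_of_weight I (k - j). x j * tuple_weight I x r)"
    proof (rule sum.reindex_bij_witness[where j = ?dec and i = ?inc])
      fix r assume r: "r \<in> {r\<in>tuples_of_weight I k. r j \<noteq> 0}"
      then show inv: "?inc (?dec r) = r" by auto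
      obtain m where m: "r j = Suc m" using r by (cases "r j") auto
      have "(\<Sum>i\<in>I. i * ?dec r i) = k - j"
        using r total[of r] total[of "?dec r"] others[of r "r j - 1"]
        by (auto simp: tuples_of_weight_def m simp del: fun_upd_apply) (simp add: m)
      then show "?dec r \<in> tuples_of_weight I (k - j)"
        using r j by (auto simp: tuples_of_weight_def PiE_iff extensional_def)
      show "x j * tuple_weight I x (?dec r) = real (r j) * tuple_weight I x r"
        using weight[of "?dec r"] m by (simp add: inv[unfolded m] fun_upd_idem)
    next
      fix r assume r: "r \<in> tuples_of_weight I (k - j)"
      show "?dec (?inc r) = r" by simp
      have "(\<Sum>i\<in>I. i * ?inc r i) = k"
        using r True total[of r] total[of "?inc r"] others[of r "Suc (r j)"]
        by (auto simp: tuples_of_weight_def simp del: fun_upd_apply) simp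
      then show "?inc r \<in> {r\<in>tuples_of_weight I k. r j \<noteq> 0}"
        using r j by (auto simp: tuples_of_weight_def PiE_iff extensional_def)
    qed
    finally show ?thesis using True by (simp add: sum_distrib_left)
  next
    case False
    have "r j = 0" if "r \<in> tuples_of_weight I k" for r
    proof (rule ccontr)
      assume "r j \<noteq> 0"
      then have "j \<le> j * r j" by simp
      also have "\<dots> \<le> k" using that total[of r] by (simp add: tuples_of_weight_def)
      finally show False using False by simp
    qed
    then have "(\<Sum>r\<in>tuples_of_weight I k. real (r j) * tuple_weight I x r) = 0"
      by (intro sum.neutral) simp
    then show ?thesis using False by simp
  qed
qed

text \<open>
  On tuples of weight \<open>k\<close> the number \<open>k\<close> can be written as $\sum_j j\,r_j$; exchanging the two sums
  leaves one marked sum for each \<open>j\<close>.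
\<close>

lemma sum_tuple_weight_recurrence:
  assumes I: "finite I" "0 \<notin> I"
  shows "real k * (\<Sum>r\<in>tuples_of_weight I k. tuple_weight I x r) =
         (\<Sum>j\<in>{j\<in>I. j \<le> k}. real j * x j * (\<Sum>r\<in>tuples_of_weight I (k - j). tuple_weight I x r))"
proof -
  have "real k * (\<Sum>r\<in>tuples_of_weight I k. tuple_weight I x r) =
        (\<Sum>r\<in>tuples_of_weight I k. (\<Sum>j\<in>I. real j * real (r j)) * tuple_weight I x r)"
    unfolding sum_distrib_left
  proof (intro sum.cong refl)
    fix r assume "r \<in> tuples_of_weight I k"
    then have "k = (\<Sum>j\<in>I. j * r j)" by (simp add: tuples_of_weight_def)
    then show "real k * tuple_weight I x r = (\<Sum>j\<in>I. real j * real (r j)) * tuple_weight I x r"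
      by simp
  qed
  also have "\<dots> = (\<Sum>j\<in>I. real j * (\<Sum>r\<in>tuples_of_weight I k. real (r j) * tuple_weight I x r))"
    by (simp add: sum_distrib_left sum_distrib_right mult.assoc sum.swap[of _ I])
  also have "\<dots> = (\<Sum>j\<in>I. if j \<le> k then
      real j * x j * (\<Sum>r\<in>tuples_of_weight I (k - j). tuple_weight I x r) else 0)"
    using I by (intro sum.cong refl) (simp add: sum_marked_tuple_weight)
  also have "\<dots> = (\<Sum>j\<in>{j\<in>I. j \<le> k}. real j * x j * (\<Sum>r\<in>tuples_of_weight I (k - j). tuple_weight I x r))"
    using I by (simp add: sum.If_cases Int_def)
  finally show ?thesis .
qed

lemma sum_tuple_weight_0:
  assumes I: "finite I" "0 \<notin> I"
  shows "(\<Sum>r\<in>tuples_of_weight I 0. tuple_weight I x r) = 1"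
proof -
  have "tuples_of_weight I 0 = {\<lambda>i\<in>I. 0}"
  proof (intro equalityI subsetI)
    fix r assume r: "r \<in> tuples_of_weight I 0"
    then have "\<forall>i\<in>I. i * r i = 0" using I by (simp add: tuples_of_weight_def)
    then have "\<forall>i\<in>I. r i = 0" using I by (metis mult_eq_0_iff)
    then show "r \<in> {\<lambda>i\<in>I. 0}"
      using r by (auto simp: tuples_of_weight_def PiE_iff extensional_def fun_eq_iff)
  qed (auto simp: tuples_of_weight_def)
  then show ?thesis by (simp add: tuple_weight_def)
qed

text \<open>
  For \<open>k \<ge> 1\<close> the recurrence determines \<open>a k\<close> from smaller arguments, so its solutions are the
  multiples of a single one, which the weighted tuples provide.
\<close>

lemma recurrence_solution:
  assumes rec: "\<And>k. real k * a k = (\<Sum>j=1..k. real j * x j * a (k - j))"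
  shows "a k = a 0 * (\<Sum>r\<in>weighted_tuples k.
                    (\<Prod>i=1..k. x i ^ r i) / (\<Prod>i=1..k. fact (r i)))"
proof -
  \<comment> \<open>The index set stays \<open>{1..k}\<close> for all weights \<open>l \<le> k\<close>; indices above \<open>l\<close> contribute nothing
      to the recurrence at \<open>l\<close>.\<close>
  define S where "S l = (\<Sum>r\<in>tuples_of_weight {1..k} l. tuple_weight {1..k} x r)" for l
  have "a l = a 0 * S l" if "l \<le> k" for l
    using that
  proof (induction l rule: less_induct)
    case (less l)
    show ?case
    proof (cases "l = 0")
      case True
      then show ?thesis by (simp add: S_def sum_tuple_weight_0)
    next
      case False
      have range: "{j\<in>{1..k}. j \<le> l} = {1..l}" using less.prems by auto
      have "real l * a l = (\<Sum>j=1..l. real j * x j * (a 0 * S (l - j)))"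
        unfolding rec
      proof (intro sum.cong refl)
        fix j assume "j \<in> {1..l}"
        then have "a (l - j) = a 0 * S (l - j)" using less.prems by (intro less.IH) auto
        then show "real j * x j * a (l - j) = real j * x j * (a 0 * S (l - j))" by (simp only:)
      qed
      also have "\<dots> = a 0 * (\<Sum>j=1..l. real j * x j * S (l - j))"
        by (simp add: sum_distrib_left algebra_simps)
      also have "(\<Sum>j=1..l. real j * x j * S (l - j)) = real l * S l"
        unfolding S_def by (subst sum_tuple_weight_recurrence) (simp_all only: range, simp_all)
      finally have "real l * a l = real l * (a 0 * S l)" by simp
      then show ?thesis using False by simp
    qed
  qed
  from this[of k] show ?thesis
    by (simp add: S_def tuple_weight_def tuples_of_weight_def weighted_tuples_def prod_dividef)
qed

section \<open>Convolution semigroups on the naturals with given jump rates\<close>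

locale nat_convolution_semigroup =
  fixes p :: "real \<Rightarrow> nat \<Rightarrow> real" and c :: "nat \<Rightarrow> real"
  assumes nonneg: "\<And>s k. 0 < s \<Longrightarrow> 0 \<le> p s k"
    and total: "\<And>s. 0 < s \<Longrightarrow> p s sums 1"
    and convolution: "\<And>s t k. 0 < s \<Longrightarrow> 0 < t \<Longrightarrow> p (s + t) k = (\<Sum>i=0..k. p s i * p t (k - i))"
    and rate: "\<And>k. 1 \<le> k \<Longrightarrow> ((\<lambda>s. p s k / s) \<longlongrightarrow> c k) (at_right 0)"
begin

lemma partial_sum_le:
  assumes "0 < s" "finite A" shows "sum (p s) A \<le> 1"
  using sum_le_suminf[of "p s" A] total[OF assms(1)] nonneg assms by (auto simp: sums_iff)

lemma le_1: "0 < s \<Longrightarrow> p s k \<le> 1"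
  using partial_sum_le[of s "{k}"] by simp

lemma sum_positive_le:
  assumes "0 < s" shows "(\<Sum>j=1..K. p s j) \<le> 1 - p s 0"
proof -
  have "{0..K} = insert 0 {1..K}" by auto
  then show ?thesis using partial_sum_le[of s "{0..K}"] assms by simp
qed

lemma fps_power: "0 < s \<Longrightarrow> Abs_fps (p (real (Suc n) * s)) = Abs_fps (p s) ^ Suc n"
proof (induction n)
  case (Suc n)
  have "p (real (Suc (Suc n)) * s) = p (s + real (Suc n) * s)"
    by (simp add: algebra_simps)
  moreover have "Abs_fps (p (s + real (Suc n) * s)) = Abs_fps (p s) * Abs_fps (p (real (Suc n) * s))"
    by (rule fps_ext) (use Suc.prems in \<open>simp add: fps_mult_nth convolution del: of_nat_Suc\<close>)
  ultimately show ?case using Suc by simp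
qed simp

lemma zero_power:
  assumes "0 < t" shows "p (t / real (Suc n)) 0 ^ Suc n = p t 0"
proof -
  have "Abs_fps (p t) = Abs_fps (p (t / real (Suc n))) ^ Suc n"
    using fps_power[of "t / real (Suc n)" n] assms by (simp del: of_nat_Suc power_Suc)
  then have "fps_nth (Abs_fps (p t)) 0 = fps_nth (Abs_fps (p (t / real (Suc n))) ^ Suc n) 0"
    by simp
  then show ?thesis by (simp only: fps_power_zeroth fps_nth_Abs_fps)
qed

text \<open>
  If \<open>p t 0\<close> vanished, so would \<open>p h 0\<close> for every fraction \<open>h = t / n\<close>; each of the \<open>n\<close> pieces of
  the time interval would then almost surely contain an event, so \<open>p t k = 0\<close> whenever \<open>k < n\<close>.
  As \<open>n\<close> is arbitrary, no mass would be left.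
\<close>

lemma p_zero_pos:
  assumes t: "0 < t" shows "0 < p t 0"
proof (rule ccontr)
  assume "\<not> 0 < p t 0"
  then have t0: "p t 0 = 0" using nonneg[OF t, of 0] by simp
  have "p t k = 0" for k
  proof -
    let ?h = "t / real (Suc k)"
    have h: "0 < ?h" using t by simp
    have h0: "p ?h 0 = 0" using zero_power[OF t, of k] t0 power_not_zero by metis
    \<comment> \<open>In a sum of \<open>m + 1\<close> variables that are all positive, values up to \<open>m\<close> have no mass.\<close>
    have "\<forall>i\<le>m. p (real (Suc m) * ?h) i = 0" for m
    proof (induction m)
      case (Suc m)
      show ?case
      proof (intro allI impI)
        fix i assume i: "i \<le> Suc m"
        have "p (real (Suc (Suc m)) * ?h) i = p (real (Suc m) * ?h + ?h) i"
          by (rule arg_cong[where f = "\<lambda>u. p u i"]) (simp only: of_nat_Suc[of "Suc m"] ring_distribs mult_1 add.commute)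
        also have "\<dots> = (\<Sum>j=0..i. p (real (Suc m) * ?h) j * p ?h (i - j))"
          by (rule convolution[OF _ h]) (use t in \<open>simp del: of_nat_Suc\<close>)
        also have "\<dots> = 0"
        proof (intro sum.neutral ballI)
          fix j assume "j \<in> {0..i}"
          then have "j \<le> m \<or> i - j = 0" using i by auto
          then show "p (real (Suc m) * ?h) j * p ?h (i - j) = 0" using Suc h0 by auto
        qed
        finally show "p (real (Suc (Suc m)) * ?h) i = 0" .
      qed
    qed (use h0 in simp)
    from this[of k] show ?thesis by (simp del: of_nat_Suc)
  qed
  then have "p t = (\<lambda>_. 0)" by auto
  then show False using total[OF t] sums_unique2[OF sums_zero] by force
qed

lemma zero_root:
  assumes "0 < t" shows "p (t / real (Suc n)) 0 = exp (ln (p t 0) / real (Suc n))"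
proof -
  have pos: "0 < p (t / real (Suc n)) 0" by (rule p_zero_pos) (use assms in simp)
  have "ln (p t 0) = real (Suc n) * ln (p (t / real (Suc n)) 0)"
    using pos by (subst zero_power[OF assms, of n, symmetric]) (simp only: ln_realpow)
  then show ?thesis using pos by (simp del: of_nat_Suc)
qed

lemma zero_tendsto_1:
  assumes "0 < t" shows "(\<lambda>n. p (t / real (Suc n)) 0) \<longlonglongrightarrow> 1"
  unfolding zero_root[OF assms] by real_asymp

lemma zero_deficit_tendsto:
  assumes "0 < t"
  shows "(\<lambda>n. real (Suc n) * (1 - p (t / real (Suc n)) 0)) \<longlonglongrightarrow> - ln (p t 0)"
  unfolding zero_root[OF assms] by real_asymp

text \<open>
  The distributions at times \<open>t - h\<close> and \<open>t\<close> can differ only through an event in a piece of length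
  \<open>h\<close>, which has probability \<open>1 - p h 0\<close>.
\<close>

lemma tendsto_before:
  assumes t: "0 < t"
  shows "(\<lambda>n. p (t - t / real (Suc (Suc n))) k) \<longlonglongrightarrow> p t k"
proof -
  have bound: "\<bar>p (t - h) k - p t k\<bar> \<le> 1 - p h 0" if h: "0 < h" "h < t" for h
  proof -
    have pos: "0 < t - h" using h by simp
    have "p t k = (\<Sum>i=0..k. p h i * p (t - h) (k - i))"
      using convolution[OF h(1) pos, of k] by simp
    also have "{0..k} = insert 0 {1..k}" by auto
    finally have eq: "p t k = p h 0 * p (t - h) k + (\<Sum>i=1..k. p h i * p (t - h) (k - i))"
      by simp
    have "(\<Sum>i=1..k. p h i * p (t - h) (k - i)) \<le> (\<Sum>i=1..k. p h i * 1)"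
      using h pos by (intro sum_mono mult_left_mono le_1 nonneg)
    also have "\<dots> \<le> 1 - p h 0" using sum_positive_le[OF h(1)] by simp
    finally have "p t k \<le> p h 0 * p (t - h) k + (1 - p h 0)" using eq by simp
    moreover have "p h 0 * p (t - h) k \<le> 1 * p (t - h) k"
      using h pos by (intro mult_right_mono le_1 nonneg)
    moreover have "(1 - p h 0) * p (t - h) k \<le> (1 - p h 0) * 1"
      using h pos le_1[OF h(1), of 0] by (intro mult_left_mono le_1) auto
    moreover have "0 \<le> (\<Sum>i=1..k. p h i * p (t - h) (k - i))"
      using h pos by (intro sum_nonneg mult_nonneg_nonneg nonneg)
    ultimately show ?thesis using eq by (simp add: algebra_simps)
  qed
  have "(\<lambda>n. p (t - t / real (Suc (Suc n))) k - p t k) \<longlonglongrightarrow> 0"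
  proof (rule Lim_null_comparison)
    show "\<forall>\<^sub>F n in sequentially. norm (p (t - t / real (Suc (Suc n))) k - p t k)
            \<le> 1 - p (t / real (Suc (Suc n))) 0"
      using t by (intro always_eventually allI) (simp only: real_norm_def, rule bound, auto simp: field_simps add_pos_nonneg)
    show "(\<lambda>n. 1 - p (t / real (Suc (Suc n))) 0) \<longlonglongrightarrow> 0"
      using tendsto_diff[OF tendsto_const[of 1] LIMSEQ_Suc[OF zero_tendsto_1[OF t]]] by simp
  qed
  then show ?thesis by (rule LIM_zero_cancel)
qed

lemma rate_sequentially:
  assumes t: "0 < t" and j: "1 \<le> j"
  shows "(\<lambda>n. real (Suc n) * p (t / real (Suc n)) j) \<longlonglongrightarrow> t * c j"
proof -
  have "filterlim (\<lambda>n. t / real (Suc n)) (at_right 0) sequentially"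
    using t by real_asymp
  from filterlim_compose[OF rate[OF j] this]
  have "(\<lambda>n. t * (p (t / real (Suc n)) j / (t / real (Suc n)))) \<longlonglongrightarrow> t * c j"
    by (intro tendsto_mult tendsto_const)
  then show ?thesis using t by (simp add: mult.commute del: of_nat_Suc)
qed

text \<open>
  Coefficient form of $(P_h^n)' = n P_h' P_h^{n-1}$ for generating functions. Two or more pieces are
  taken, so that \<open>t - h n\<close> is a positive time.
\<close>

lemma discrete_recurrence:
  assumes t: "0 < t"
  defines "h \<equiv> \<lambda>n. t / real (Suc (Suc n))"
  shows "real k * p t k =
         (\<Sum>j=1..k. real j * (real (Suc (Suc n)) * p (h n) j) * p (t - h n) (k - j))"
proof (cases k)
  case (Suc m)
  let ?P = "Abs_fps (p (h n))"
  have h: "0 < h n" using t by (simp add: h_def)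
  have times: "real (Suc (Suc n)) * h n = t" "real (Suc n) * h n = t - h n"
    using t by (simp_all add: h_def field_simps)
  have "Abs_fps (p t) = ?P ^ Suc (Suc n)" "Abs_fps (p (t - h n)) = ?P ^ Suc n"
    using fps_power[OF h, of "Suc n"] fps_power[OF h, of n] by (simp_all only: times)
  then have "fps_deriv (Abs_fps (p t)) =
      fps_const (real (Suc (Suc n))) * fps_deriv ?P * Abs_fps (p (t - h n))"
    by (simp only: fps_deriv_power diff_Suc_1)
  then have "fps_nth (fps_deriv (Abs_fps (p t))) m =
      fps_nth (fps_const (real (Suc (Suc n))) * (fps_deriv ?P * Abs_fps (p (t - h n)))) m"
    by (simp only: mult.assoc)
  then have "real k * p t k = real (Suc (Suc n)) *
      (\<Sum>j=0..m. real (Suc j) * p (h n) (Suc j) * p (t - h n) (m - j))"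
    by (simp only: fps_mult_left_const_nth fps_mult_nth[of "fps_deriv ?P"] fps_deriv_nth fps_nth_Abs_fps Suc Suc_eq_plus1)
  also have "\<dots> = (\<Sum>j=0..m. real (Suc j) * (real (Suc (Suc n)) * p (h n) (Suc j)) * p (t - h n) (k - Suc j))"
    unfolding sum_distrib_left Suc by (intro sum.cong refl) (simp add: algebra_simps)
  also have "\<dots> = (\<Sum>j=1..k. real j * (real (Suc (Suc n)) * p (h n) j) * p (t - h n) (k - j))"
    using sum.shift_bounds_cl_Suc_ivl[of "\<lambda>j. real j * (real (Suc (Suc n)) * p (h n) j) * p (t - h n) (k - j)" 0 m]
    by (simp only: Suc One_nat_def)
  finally show ?thesis .
qed simp

lemma recurrence:
  assumes t: "0 < t"
  shows "real k * p t k = (\<Sum>j=1..k. real j * (t * c j) * p t (k - j))"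
proof (rule LIMSEQ_unique)
  show "(\<lambda>n. \<Sum>j=1..k. real j * (real (Suc (Suc n)) * p (t / real (Suc (Suc n))) j)
           * p (t - t / real (Suc (Suc n))) (k - j))
        \<longlonglongrightarrow> (\<Sum>j=1..k. real j * (t * c j) * p t (k - j))"
    by (intro tendsto_sum tendsto_mult tendsto_const tendsto_before[OF t]
        LIMSEQ_Suc[OF rate_sequentially[OF t]]) simp
  show "(\<lambda>n. \<Sum>j=1..k. real j * (real (Suc (Suc n)) * p (t / real (Suc (Suc n))) j)
           * p (t - t / real (Suc (Suc n))) (k - j)) \<longlonglongrightarrow> real k * p t k"
    unfolding discrete_recurrence[OF t, symmetric] by (rule tendsto_const)
qed

lemma rate_nonneg:
  assumes "1 \<le> j" shows "0 \<le> c j"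
proof (rule tendsto_lowerbound[OF rate[OF assms]])
  show "\<forall>\<^sub>F s in at_right 0. 0 \<le> p s j / s"
    using eventually_at_right_less[of "0::real"] by eventually_elim (simp add: nonneg)
qed simp

text \<open>
  Only finitely many jump sizes are kept, because the convergence of the rates is not uniform in the
  jump size.
\<close>

lemma rate_partial_sum_le:
  assumes t: "0 < t" shows "(\<Sum>j=1..K. t * c j) \<le> - ln (p t 0)"
proof (rule LIMSEQ_le[OF _ zero_deficit_tendsto[OF t]])
  show "(\<lambda>n. \<Sum>j=1..K. real (Suc n) * p (t / real (Suc n)) j) \<longlonglongrightarrow> (\<Sum>j=1..K. t * c j)"
    by (intro tendsto_sum rate_sequentially[OF t]) simp
  show "\<exists>N. \<forall>n\<ge>N. (\<Sum>j=1..K. real (Suc n) * p (t / real (Suc n)) j)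
             \<le> real (Suc n) * (1 - p (t / real (Suc n)) 0)"
    unfolding sum_distrib_left[symmetric]
    using t by (intro exI allI impI mult_left_mono sum_positive_le) auto
qed

lemma rate_summable: "summable (\<lambda>n. c (Suc n))"
proof (rule summableI_nonneg_bounded)
  show "0 \<le> c (Suc n)" for n by (rule rate_nonneg) simp
  show "(\<Sum>i<n. c (Suc i)) \<le> - ln (p 1 0)" for n
    using rate_partial_sum_le[of 1 n] by (simp add: sum.atLeast1_atMost_eq)
qed

text \<open>
  This supplies the uniformity that the rates lack: since \<open>j \<le> k\<close>, the recurrence bounds \<open>p h k\<close>
  by a term of the Cauchy product of \<open>\<lambda>j. h * c j\<close> and \<open>p h\<close>, and \<open>p h\<close> has total mass 1.
\<close>

lemma zero_deficit_le:
  assumes h: "0 < h" shows "1 - p h 0 \<le> (\<Sum>n. h * c (Suc n))"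
proof -
  have sc: "summable (\<lambda>n. h * c (Suc n))" by (intro summable_mult rate_summable)
  have cn: "0 \<le> h * c (Suc n)" for n using h rate_nonneg by simp
  have "(\<lambda>k. \<Sum>i\<le>k. h * c (Suc i) * p h (k - i)) sums ((\<Sum>n. h * c (Suc n)) * (\<Sum>n. p h n))"
    using sc total[OF h] h by (intro Cauchy_product_sums) (auto simp: cn nonneg sums_iff abs_mult rate_nonneg)
  then have product: "(\<lambda>k. \<Sum>i\<le>k. h * c (Suc i) * p h (k - i)) sums (\<Sum>n. h * c (Suc n))"
    using total[OF h] by (simp add: sums_iff)
  have positive: "(\<lambda>k. p h (Suc k)) sums (1 - p h 0)"
    using total[OF h] by (subst sums_Suc_iff) simp
  have le: "p h (Suc k) \<le> (\<Sum>i\<le>k. h * c (Suc i) * p h (k - i))" for k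
  proof -
    have "real (Suc k) * p h (Suc k) = (\<Sum>i=0..k. real (Suc i) * (h * c (Suc i)) * p h (Suc k - Suc i))"
      unfolding recurrence[OF h]
      using sum.shift_bounds_cl_Suc_ivl[of "\<lambda>j. real j * (h * c j) * p h (Suc k - j)" 0 k]
      by (simp only: One_nat_def)
    also have "\<dots> \<le> (\<Sum>i=0..k. real (Suc k) * (h * c (Suc i)) * p h (k - i))"
      using h cn by (intro sum_mono) (simp only: diff_Suc_Suc, intro mult_right_mono, auto simp: nonneg)
    also have "\<dots> = real (Suc k) * (\<Sum>i\<le>k. h * c (Suc i) * p h (k - i))"
      by (simp add: sum_distrib_left atLeast0AtMost mult.assoc)
    finally show ?thesis by (simp del: of_nat_Suc)
  qed
  show ?thesis by (rule sums_le[OF le positive product])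
qed

lemma zero_eq_exp:
  assumes t: "0 < t" shows "p t 0 = exp (- (\<Sum>n. t * c (Suc n)))"
proof -
  let ?L = "\<Sum>n. c (Suc n)"
  have scale: "(\<Sum>n. h * c (Suc n)) = h * ?L" for h
    by (rule suminf_mult[OF rate_summable])
  have "- ln (p t 0) \<le> t * ?L"
  proof (rule LIMSEQ_le_const2[OF zero_deficit_tendsto[OF t]], intro exI allI impI)
    fix n
    have "1 - p (t / real (Suc n)) 0 \<le> t / real (Suc n) * ?L"
      using zero_deficit_le[of "t / real (Suc n)"] t unfolding scale by simp
    then have "real (Suc n) * (1 - p (t / real (Suc n)) 0) \<le> real (Suc n) * (t / real (Suc n) * ?L)"
      by (intro mult_left_mono) auto
    then show "real (Suc n) * (1 - p (t / real (Suc n)) 0) \<le> t * ?L" by (simp del: of_nat_Suc)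
  qed
  moreover have "(\<Sum>n. t * c (Suc n)) \<le> - ln (p t 0)"
  proof (rule suminf_le_const)
    show "summable (\<lambda>n. t * c (Suc n))" by (intro summable_mult rate_summable)
    show "(\<Sum>i<n. t * c (Suc i)) \<le> - ln (p t 0)" for n
      using rate_partial_sum_le[OF t, of n] by (simp add: sum.atLeast1_atMost_eq)
  qed
  ultimately have "ln (p t 0) = - (\<Sum>n. t * c (Suc n))" by (simp add: scale)
  then show ?thesis using exp_ln[OF p_zero_pos[OF t]] by simp
qed

theorem multiple_Poisson_law:
  assumes t: "0 < t"
  shows "p t k = exp (- (\<Sum>n. t * c (Suc n))) *
           (\<Sum>r\<in>weighted_tuples k. (\<Prod>i=1..k. (t * c i) ^ r i) / (\<Prod>i=1..k. fact (r i)))"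
  using recurrence_solution[of "p t" "\<lambda>j. t * c j" k, OF recurrence[OF t]] zero_eq_exp[OF t]
  by simp

end

section \<open>The marginals of a Bell-Touchard process\<close>

context bell_touchard_process
begin

abbreviation marginal :: "real \<Rightarrow> nat \<Rightarrow> real" where
  "marginal s k \<equiv> measure M {\<omega> \<in> space M. N s \<omega> = k}"

lemma increment_measurable:
  "0 \<le> s \<Longrightarrow> 0 \<le> t \<Longrightarrow> random_variable (count_space UNIV) (increment N s t)"
  using rv[of s] rv[of t] unfolding increment_def by measurable

lemma prob_increment:
  assumes "0 \<le> t" "0 < s"
  shows "measure M {\<omega> \<in> space M. increment N t (t + s) \<omega> = k} = marginal s k"
proof -
  have eq: "measure (distr M (count_space UNIV) (increment N u (u + s))) {k} =
         measure M {\<omega> \<in> space M. increment N u (u + s) \<omega> = k}" if "0 \<le> u" for u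
    using increment_measurable[of u "u + s"] that assms
    by (subst measure_distr) (auto intro!: arg_cong[where f = "measure M"])
  have "distr M (count_space UNIV) (increment N t (t + s)) =
        distr M (count_space UNIV) (increment N 0 (0 + s))"
    using stationary assms unfolding stationary_increments_def by blast
  then have "measure M {\<omega> \<in> space M. increment N t (t + s) \<omega> = k} =
             measure M {\<omega> \<in> space M. increment N 0 (0 + s) \<omega> = k}"
    using eq[of t] eq[of 0] assms by simp
  also have "{\<omega> \<in> space M. increment N 0 (0 + s) \<omega> = k} = {\<omega> \<in> space M. N s \<omega> = k}"
    using start_0 by (auto simp: increment_def)
  finally show ?thesis .
qed

text \<open>
  As the process starts at 0, its value at time \<open>s\<close> is the increment over the first of the two
  intervals with end points \<open>0\<close>, \<open>s\<close>, \<open>s + t\<close>.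
\<close>

lemma prob_consecutive_increments:
  assumes "0 < s" "0 < t"
  shows "measure M {\<omega> \<in> space M. N s \<omega> = i \<and> increment N s (s + t) \<omega> = j} =
         marginal s i * marginal t j"
proof -
  define \<tau> where "\<tau> = (\<lambda>n::nat. if n = 0 then 0 else if n = 1 then s else s + t)"
  have "0 \<le> \<tau> 0" "\<forall>i<2. \<tau> i < \<tau> (Suc i)"
    using assms by (auto simp: \<tau>_def less_2_cases_iff)
  then have "indep_vars (\<lambda>_. count_space UNIV) (\<lambda>i. increment N (\<tau> i) (\<tau> (Suc i))) {..<2}"
    using independent unfolding independent_increments_def by blast
  from indep_varsD[OF this, of "{..<2}" "\<lambda>n. if n = 0 then {i} else {j}"]
  have "measure M (\<Inter>n<2. increment N (\<tau> n) (\<tau> (Suc n)) -` (if n = 0 then {i} else {j}) \<inter> space M) =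
     (\<Prod>n<2. measure M (increment N (\<tau> n) (\<tau> (Suc n)) -` (if n = 0 then {i} else {j}) \<inter> space M))"
    by (auto simp: lessThan_empty_iff)
  also have "(\<Inter>n<2. increment N (\<tau> n) (\<tau> (Suc n)) -` (if n = 0 then {i} else {j}) \<inter> space M) =
     {\<omega> \<in> space M. N s \<omega> = i \<and> increment N s (s + t) \<omega> = j}"
    using start_0 by (auto simp: \<tau>_def numeral_2_eq_2 lessThan_Suc increment_def)
  also have "(\<Prod>n<2. measure M (increment N (\<tau> n) (\<tau> (Suc n)) -` (if n = 0 then {i} else {j}) \<inter> space M)) =
     measure M {\<omega> \<in> space M. increment N 0 (0 + s) \<omega> = i} *
     measure M {\<omega> \<in> space M. increment N s (s + t) \<omega> = j}"
    by (simp add: \<tau>_def numeral_2_eq_2 lessThan_Suc vimage_def Int_def conj_commute mult.commute)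
  finally show ?thesis using assms by (simp only: prob_increment order_refl less_imp_le)
qed

lemma marginal_convolution:
  assumes "0 < s" "0 < t"
  shows "marginal (s + t) k = (\<Sum>i=0..k. marginal s i * marginal t (k - i))"
proof -
  let ?E = "\<lambda>i. {\<omega> \<in> space M. N s \<omega> = i \<and> increment N s (s + t) \<omega> = k - i}"
  have "{\<omega> \<in> space M. N (s + t) \<omega> = k} = (\<Union>i\<in>{0..k}. ?E i)"
    using nondecreasing[of s "s + t"] assms by (force simp: increment_def)
  then have "marginal (s + t) k = measure M (\<Union>i\<in>{0..k}. ?E i)" by simp
  also have "\<dots> = (\<Sum>i=0..k. measure M (?E i))"
  proof (rule finite_measure_finite_Union)
    have [measurable]: "random_variable (count_space UNIV) (N s)"
      "random_variable (count_space UNIV) (increment N s (s + t))"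
      using assms by (auto intro!: rv increment_measurable)
    show "?E ` {0..k} \<subseteq> events" by auto
  qed (auto simp: disjoint_family_on_def)
  also have "\<dots> = (\<Sum>i=0..k. marginal s i * marginal t (k - i))"
    using assms by (simp add: prob_consecutive_increments)
  finally show ?thesis .
qed

lemma marginal_sums_1:
  assumes "0 < s" shows "marginal s sums 1"
proof -
  have [measurable]: "random_variable (count_space UNIV) (N s)" using assms by (intro rv) simp
  have "(\<lambda>k. marginal s k) sums measure M (\<Union>k. {\<omega> \<in> space M. N s \<omega> = k})"
    by (rule finite_measure_UNION) (auto simp: disjoint_family_on_def)
  also have "(\<Union>k. {\<omega> \<in> space M. N s \<omega> = k}) = space M" by auto
  finally show ?thesis by (simp add: prob_space)
qed

text \<open>
  The expansion is given for increments that start at a positive time; by stationarity any such time,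
  here 1, may stand in for 0.
\<close>

lemma marginal_rate:
  assumes k: "1 \<le> k"
  shows "((\<lambda>s. marginal s k / s) \<longlongrightarrow> \<alpha> * \<theta> ^ k / fact k) (at_right 0)"
proof -
  obtain f where f: "is_little_o f"
    and eq: "\<And>s. 0 < s \<Longrightarrow> measure M {\<omega> \<in> space M. increment N 1 (1 + s) \<omega> = k}
                     = \<alpha> * s * \<theta> ^ k / fact k + f s"
    using small_increments[OF k, of 1] by auto
  have "((\<lambda>s. f s / s) \<longlongrightarrow> 0) (at_right 0)"
    using f unfolding is_little_o_def by (rule filterlim_at_split[THEN iffD1, THEN conjunct2])
  then have lim: "((\<lambda>s. \<alpha> * \<theta> ^ k / fact k + f s / s) \<longlongrightarrow> \<alpha> * \<theta> ^ k / fact k) (at_right 0)"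
    using tendsto_add[OF tendsto_const] by fastforce
  have "\<forall>\<^sub>F s in at_right 0. \<alpha> * \<theta> ^ k / fact k + f s / s = marginal s k / s"
    using eventually_at_right_less[of "0::real"]
  proof eventually_elim
    case (elim s)
    then show ?case using eq[of s] prob_increment[of 1 s k] by (simp add: field_simps)
  qed
  then show ?thesis by (rule Lim_transform_eventually[OF lim])
qed

lemma marginal_semigroup:
  assumes "\<And>n. 1 \<le> n \<Longrightarrow> c n = \<alpha> * \<theta> ^ n / fact n"
  shows "nat_convolution_semigroup marginal c"
  by unfold_locales
    (use assms marginal_rate in \<open>auto simp: marginal_sums_1 marginal_convolution\<close>)

end

theorem proposition3p1:
  fixes M :: "'a measure" and N :: "real \<Rightarrow> 'a \<Rightarrow> nat"
    and \<alpha> \<theta> :: real and c :: "nat \<Rightarrow> real" and t :: real and k :: nat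
  assumes "\<alpha> > 0" and "\<theta> > 0"
    and "bell_touchard_process M N \<alpha> \<theta>"
    and "\<And>n. n \<ge> 1 \<Longrightarrow> c n = \<alpha> * \<theta> ^ n / fact n"
    and "t > 0" and "k \<ge> 1"
  shows "measure M {\<omega> \<in> space M. N t \<omega> = k} =
           exp (- (\<Sum>n. t * c (Suc n))) *
           (\<Sum>r\<in>weighted_tuples k.
              (\<Prod>i=1..k. (t * c i) ^ r i) / (\<Prod>i=1..k. fact (r i)))"
proof -
  interpret bell_touchard_process M N \<alpha> \<theta> by fact
  interpret nat_convolution_semigroup marginal c
    using assms(4) by (rule marginal_semigroup)
  show ?thesis by (rule multiple_Poisson_law) fact
qed

end
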